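(* Let $(X,d)$ be a complete convergence-symmetric metric space. Then $X$ is a Baire space: for every sequence $(A_n)_{n\ge1}$ of closed subsets of $X$ with empty interior, the union $\bigcup_{n=1}^\infty A_n$ has empty interior.
   Context: A metric on a non-empty set $X$ is a function $d:X\times X\to[0,\infty)$ with $d(x,y)=0$ iff $x=y$, and $d(x,z)\le d(x,y)+d(y,z)$ for all $x,y,z$; symmetry is NOT assumed. $(X,d)$ is convergence-symmetric if for any two sequences $(p_n),(q_n)$ in $X$, $d(p_n,q_n)\to0$ if and only if $d(q_n,p_n)\to0$. The topology of such a space is the one induced by the symmetric metric $d_{\mathrm{arith}}(x,y)=\frac12(d(x,y)+d(y,x))$. A sequence $(x_n)$ is Cauchy if for every $\epsilon>0$ there is $N$ with $d(x_i,x_{i+k})<\epsilon$ for all $i\ge N$, $k\ge0$ (in a convergence-symmetric space this is equivalent to the same condition with $d(x_{i+k},x_i)$). The space is complete if every Cauchy sequence converges, where $x_n\to x$ means $d(x_n,x)\to0$. *)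

theory Defs
  imports "HOL-Analysis.Analysis"
begin

text \<open>The distance is a total function on the ambient type; only its values on the carrier
  \<open>X\<close> matter, and nothing is assumed about it outside \<open>X\<close>.\<close>

definition asym_metric_on :: "'a set \<Rightarrow> ('a \<Rightarrow> 'a \<Rightarrow> real) \<Rightarrow> bool" where
  "asym_metric_on X d \<longleftrightarrow>
     X \<noteq> {} \<and>
     (\<forall>x\<in>X. \<forall>y\<in>X. 0 \<le> d x y) \<and>
     (\<forall>x\<in>X. \<forall>y\<in>X. d x y = 0 \<longleftrightarrow> x = y) \<and>
     (\<forall>x\<in>X. \<forall>y\<in>X. \<forall>z\<in>X. d x z \<le> d x y + d y z)"

definition convergence_symmetric :: "'a set \<Rightarrow> ('a \<Rightarrow> 'a \<Rightarrow> real) \<Rightarrow> bool" where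
  "convergence_symmetric X d \<longleftrightarrow>
     (\<forall>p q :: nat \<Rightarrow> 'a. range p \<subseteq> X \<longrightarrow> range q \<subseteq> X \<longrightarrow>
        ((\<lambda>n. d (p n) (q n)) \<longlonglongrightarrow> 0 \<longleftrightarrow> (\<lambda>n. d (q n) (p n)) \<longlonglongrightarrow> 0))"

text \<open>The value 0 outside \<open>X\<close> is needed because the library locale \<open>Metric_space\<close> demands
  nonnegativity on the whole type.\<close>

definition d_arith :: "'a set \<Rightarrow> ('a \<Rightarrow> 'a \<Rightarrow> real) \<Rightarrow> 'a \<Rightarrow> 'a \<Rightarrow> real" where
  "d_arith X d x y = (if x \<in> X \<and> y \<in> X then (d x y + d y x) / 2 else 0)"

lemma Metric_space_d_arith:
  assumes "asym_metric_on X d"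
  shows "Metric_space X (d_arith X d)"
proof
  fix x y z
  have nn: "0 \<le> d u v" if "u \<in> X" "v \<in> X" for u v
    using assms that by (auto simp: asym_metric_on_def)
  show "0 \<le> d_arith X d x y" by (simp add: d_arith_def nn)
  show "d_arith X d x y = d_arith X d y x" by (simp add: d_arith_def add.commute)
  { assume xy: "x \<in> X" "y \<in> X"
    then have "d x y = 0 \<longleftrightarrow> x = y" "d y x = 0 \<longleftrightarrow> x = y"
      using assms by (auto simp: asym_metric_on_def)
    with nn[OF xy] nn[OF xy(2) xy(1)] show "d_arith X d x y = 0 \<longleftrightarrow> x = y"
      using xy by (auto simp: d_arith_def) }
  { assume xyz: "x \<in> X" "y \<in> X" "z \<in> X"
    then have "d x z \<le> d x y + d y z" "d z x \<le> d z y + d y x"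
      using assms by (auto simp: asym_metric_on_def)
    with xyz show "d_arith X d x z \<le> d_arith X d x y + d_arith X d y z"
      by (simp add: d_arith_def field_simps) }
qed

definition arith_topology :: "'a set \<Rightarrow> ('a \<Rightarrow> 'a \<Rightarrow> real) \<Rightarrow> 'a topology" where
  "arith_topology X d = Metric_space.mtopology X (d_arith X d)"

definition asym_Cauchy :: "('a \<Rightarrow> 'a \<Rightarrow> real) \<Rightarrow> (nat \<Rightarrow> 'a) \<Rightarrow> bool" where
  "asym_Cauchy d x \<longleftrightarrow> (\<forall>\<epsilon>>0. \<exists>N. \<forall>i\<ge>N. \<forall>k. d (x i) (x (i + k)) < \<epsilon>)"

definition asym_complete :: "'a set \<Rightarrow> ('a \<Rightarrow> 'a \<Rightarrow> real) \<Rightarrow> bool" where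
  "asym_complete X d \<longleftrightarrow>
     (\<forall>x :: nat \<Rightarrow> 'a. range x \<subseteq> X \<longrightarrow> asym_Cauchy d x \<longrightarrow>
        (\<exists>l\<in>X. (\<lambda>n. d (x n) l) \<longlonglongrightarrow> 0))"

definition Baire_space :: "'a topology \<Rightarrow> bool" where
  "Baire_space T \<longleftrightarrow>
     (\<forall>A :: nat \<Rightarrow> 'a set.
        (\<forall>n\<ge>1. closedin T (A n) \<and> T interior_of (A n) = {}) \<longrightarrow>
        T interior_of (\<Union>n\<in>{1..}. A n) = {})"

end

theory Submission
  imports Defs
begin

text \<open>The topology is metrised by \<open>d_arith X d\<close>, so the classical Baire category theorem applies
  once this symmetric metric is known to be complete. Completeness transfers in two steps. A sequence
  that is Cauchy for \<open>d_arith X d\<close> is Cauchy for \<open>d\<close>, because \<open>d\<close> is at most twice its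
  symmetrisation; hence \<open>d (x n) l\<close> tends to 0 for some \<open>l\<close>. Convergence symmetry, applied to the
  sequence and the constant sequence \<open>l\<close>, gives that \<open>d l (x n)\<close> tends to 0 as well, so the average
  of the two distances does, which is convergence for \<open>d_arith X d\<close>.\<close>

lemma asym_Cauchy_if_MCauchy_d_arith:
  assumes d: "asym_metric_on X d"
    and x: "Metric_space.MCauchy X (d_arith X d) x"
  shows "asym_Cauchy d x"
  unfolding asym_Cauchy_def
proof (intro allI impI)
  fix \<epsilon> :: real
  assume "\<epsilon> > 0"
  interpret Metric_space X "d_arith X d"
    using d by (rule Metric_space_d_arith)
  have X: "x n \<in> X" for n
    using x by (auto simp: MCauchy_def)
  obtain N where N: "\<And>m n. N \<le> m \<Longrightarrow> N \<le> n \<Longrightarrow> d_arith X d (x m) (x n) < \<epsilon> / 2"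
    using x \<open>\<epsilon> > 0\<close> unfolding MCauchy_def by (meson half_gt_zero)
  have "d (x i) (x (i + k)) < \<epsilon>" if "N \<le> i" for i k
  proof -
    have "d (x i) (x (i + k)) + d (x (i + k)) (x i) < \<epsilon>"
      using N[of i "i + k"] that X by (simp add: d_arith_def)
    moreover have "0 \<le> d (x (i + k)) (x i)"
      using d X by (simp add: asym_metric_on_def)
    ultimately show ?thesis by linarith
  qed
  then show "\<exists>N. \<forall>i\<ge>N. \<forall>k. d (x i) (x (i + k)) < \<epsilon>" by blast
qed

text \<open>Completeness of \<open>d\<close> controls only the distances towards the limit; convergence symmetry
  is what supplies the distances away from it.\<close>

lemma mcomplete_d_arith:
  assumes d: "asym_metric_on X d"
    and sym: "convergence_symmetric X d"
    and compl: "asym_complete X d"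
  shows "Metric_space.mcomplete X (d_arith X d)"
proof -
  interpret Metric_space X "d_arith X d"
    using d by (rule Metric_space_d_arith)
  have "\<exists>l. limitin mtopology x l sequentially" if x: "MCauchy x" for x
  proof -
    have X: "range x \<subseteq> X"
      using x by (simp add: MCauchy_def)
    obtain l where l: "l \<in> X" and fwd: "(\<lambda>n. d (x n) l) \<longlonglongrightarrow> 0"
      using compl X asym_Cauchy_if_MCauchy_d_arith[OF d x]
      unfolding asym_complete_def by blast
    have bwd: "(\<lambda>n. d l (x n)) \<longlonglongrightarrow> 0"
      using sym[unfolded convergence_symmetric_def, rule_format, of x "\<lambda>_. l"] X l fwd by auto
    have "(\<lambda>n. (d (x n) l + d l (x n)) / 2) \<longlonglongrightarrow> 0"
      using tendsto_divide[OF tendsto_add[OF fwd bwd] tendsto_const[of 2]] by simp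
    moreover have "(\<lambda>n. d_arith X d (x n) l) = (\<lambda>n. (d (x n) l + d l (x n)) / 2)"
      using X l by (simp add: d_arith_def range_subsetD)
    ultimately have "(\<lambda>n. d_arith X d (x n) l) \<longlonglongrightarrow> 0" by simp
    moreover have "\<forall>\<^sub>F n in sequentially. x n \<in> X"
      using X by (simp add: range_subsetD)
    ultimately have "limitin mtopology x l sequentially"
      using l by (simp add: limitin_metric_dist_null)
    then show ?thesis ..
  qed
  then show ?thesis by (simp add: mcomplete_def)
qed

theorem theorem7p3:
  fixes X :: "'a set" and d :: "'a \<Rightarrow> 'a \<Rightarrow> real"
  assumes "asym_metric_on X d"
    and "convergence_symmetric X d"
    and "asym_complete X d"
  shows "Baire_space (arith_topology X d)"
  unfolding Baire_space_def arith_topology_def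
proof (intro allI impI)
  interpret Metric_space X "d_arith X d"
    using assms(1) by (rule Metric_space_d_arith)
  fix A :: "nat \<Rightarrow> 'a set"
  assume "\<forall>n\<ge>1. closedin mtopology (A n) \<and> mtopology interior_of A n = {}"
  then show "mtopology interior_of (\<Union>n\<in>{1..}. A n) = {}"
    by (intro metric_Baire_category_alt mcomplete_d_arith assms) auto
qed

end
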